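(* Let $j$ be a non-negative integer. For every positive integer $n$, $\overline{p}_{3,j+1}(n)$ equals the number of partitions of $n$ with rank $\geq j$.
   Context: A partition of $n$ is a finite multiset of positive integers summing to $n$. The rank of a partition is its largest part minus its number of parts. For positive integers $A,a$ and a partition $\pi$, $\mathrm{mex}_{A,a}(\pi)$ is the smallest element of $\{a,a+A,a+2A,\dots\}$ that is not a part of $\pi$. $\overline{p}_{A,a}(n)$ is the number of partitions $\pi$ of $n$ with $\mathrm{mex}_{A,a}(\pi)\equiv A+a \pmod{2A}$. *)

theory Defs
  imports "HOL-Library.Multiset" "HOL-Number_Theory.Cong"
begin

definition partitions :: "nat \<Rightarrow> nat multiset set" where
  "partitions n = {\<pi>. (\<forall>x \<in># \<pi>. 0 < x) \<and> sum_mset \<pi> = n}"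

(* Only meaningful for nonempty partitions, since Max {} is unspecified. *)
definition rank :: "nat multiset \<Rightarrow> int" where
  "rank \<pi> = int (Max (set_mset \<pi>)) - int (size \<pi>)"

(* The minimum exists whenever 0 < A, because \<pi> has finitely many distinct parts. *)
definition mex :: "nat \<Rightarrow> nat \<Rightarrow> nat multiset \<Rightarrow> nat" where
  "mex A a \<pi> = (LEAST m. m \<in> {a + k * A | k. True} \<and> m \<notin># \<pi>)"

definition pbar :: "nat \<Rightarrow> nat \<Rightarrow> nat \<Rightarrow> nat" where
  "pbar A a n = card {\<pi> \<in> partitions n. [mex A a \<pi> = A + a] (mod (2 * A))}"

lemma size_le_sum_mset:
  fixes \<pi> :: "nat multiset"
  assumes "\<forall>x \<in># \<pi>. 0 < x"
  shows "size \<pi> \<le> sum_mset \<pi>"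
  using assms by (induction \<pi>) auto

(* Hence card counts any set of partitions of n correctly, in particular in pbar. *)
lemma finite_partitions: "finite (partitions n)"
proof -
  have "partitions n \<subseteq> mset ` {xs. set xs \<subseteq> {..n} \<and> length xs \<le> n}"
  proof
    fix \<pi> assume \<pi>: "\<pi> \<in> partitions n"
    obtain xs where xs: "mset xs = \<pi>" using ex_mset by blast
    have "length xs \<le> n"
      using \<pi> xs size_le_sum_mset[of \<pi>] by (auto simp: partitions_def)
    moreover have "set xs \<subseteq> {..n}"
      using \<pi> xs by (auto simp: partitions_def sum_mset_sum_list intro: member_le_sum_list)
    ultimately show "\<pi> \<in> mset ` {xs. set xs \<subseteq> {..n} \<and> length xs \<le> n}"
      using xs by blast
  qed
  then show ?thesis
    by (rule finite_subset) (intro finite_imageI finite_lists_length_le finite_atMost)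
qed

end

theory Submission
  imports Defs
begin

text \<open>
  Both sides satisfy the recurrence \<open>F\<^sub>j(n + j + 1) = p(n) - F\<^bsub>j+3\<^esub>(n)\<close> with \<open>F\<^sub>j(n) = 0\<close> for
  \<open>n \<le> j\<close>, where the empty partition is regarded as having rank smaller than every \<open>j\<close>.
  For \<open>pbar\<close>, remove one part \<open>a = j + 1\<close>, which shifts the progression by one step and flips
  the parity of the position of the mex.
  For the rank, use Dyson's map: from a partition \<open>\<lambda>\<close> of \<open>n\<close> that is empty or has rank less than
  \<open>j + 3\<close>, delete the first column of its Young diagram, of length \<open>l\<close>, and add a new first row of
  length \<open>l + j + 1\<close>. This is a bijection onto the nonempty partitions of \<open>n + j + 1\<close> with rank at
  least \<open>j\<close>.
\<close>

section \<open>The mex and the recurrence for \<open>pbar\<close>\<close>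

lemma mex_props:
  assumes "0 < A"
  shows "\<exists>k. mex A a \<pi> = a + k * A" and "mex A a \<pi> \<notin># \<pi>"
proof -
  have "inj (\<lambda>k. a + k * A)"
    using assms by (auto simp: inj_def)
  then have "infinite (range (\<lambda>k. a + k * A))"
    using finite_imageD infinite_UNIV_nat by blast
  then have "\<not> range (\<lambda>k. a + k * A) \<subseteq> set_mset \<pi>"
    using finite_subset by blast
  then have "\<exists>m. m \<in> {a + k * A | k. True} \<and> m \<notin># \<pi>"
    by blast
  then have "mex A a \<pi> \<in> {a + k * A | k. True} \<and> mex A a \<pi> \<notin># \<pi>"
    unfolding mex_def by (rule LeastI_ex)
  then show "\<exists>k. mex A a \<pi> = a + k * A" and "mex A a \<pi> \<notin># \<pi>"
    by auto
qed

lemma mex_eq_start: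
  assumes "a \<notin># \<pi>"
  shows "mex A a \<pi> = a"
  unfolding mex_def
  by (rule Least_equality) (use assms in \<open>auto intro: exI[of _ 0]\<close>)

text \<open>With \<open>a\<close> present, the search for the mex starts at \<open>a + A\<close>;
  since \<open>0 < A\<close>, no later term equals \<open>a\<close>, so the extra part affects
  nothing else.\<close>

lemma mex_add_mset_start:
  assumes "0 < A"
  shows "mex A a (add_mset a \<pi>) = mex A (a + A) \<pi>"
proof -
  have "m \<in> {a + k * A | k. True} \<and> m \<notin># add_mset a \<pi> \<longleftrightarrow>
        m \<in> {a + A + k * A | k. True} \<and> m \<notin># \<pi>" (is "?L \<longleftrightarrow> ?R") for m
  proof
    assume ?L
    then obtain k where k: "m = a + k * A" "m \<noteq> a" "m \<notin># \<pi>"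
      by auto
    then obtain i where "k = Suc i"
      by (cases k) auto
    with k show ?R
      by auto
  next
    assume ?R
    then obtain k where k: "m = a + A + k * A" "m \<notin># \<pi>"
      by auto
    then have "m = a + Suc k * A" "m \<notin># add_mset a \<pi>"
      using assms by auto
    then show ?L
      by blast
  qed
  then show ?thesis
    unfolding mex_def by presburger
qed

text \<open>Only the parity of \<open>k\<close> matters, so the condition defining
  \<open>pbar\<close> says that the mex sits at an odd position of the progression, counted from
  0.\<close>

lemma cong_add_mult_double_iff:
  fixes A a k :: nat
  assumes "0 < A"
  shows "[a + k * A = a] (mod (2 * A)) \<longleftrightarrow> even k"
    and "[a + k * A = A + a] (mod (2 * A)) \<longleftrightarrow> odd k"
proof -
  \<comment> \<open>Cancel \<open>a\<close> and write \<open>(k * A) mod (2 * A)\<close> as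
    \<open>(k mod 2) * A\<close>.\<close>
  have "[a + k * A = a + i * A] (mod (2 * A)) \<longleftrightarrow> [k = i] (mod 2)" for i
    using assms unfolding cong_add_lcancel_nat by (simp add: cong_def mult_mod_left[symmetric])
  from this[of 0] this[of 1] show
    "[a + k * A = a] (mod (2 * A)) \<longleftrightarrow> even k"
    "[a + k * A = A + a] (mod (2 * A)) \<longleftrightarrow> odd k"
    by (simp_all add: cong_def add.commute even_iff_mod_2_eq_zero odd_iff_mod_2_eq_one)
qed

lemma not_cong_add_modulus_half:
  fixes A a :: nat
  assumes "0 < A"
  shows "\<not> [a = A + a] (mod (2 * A))"
  using cong_add_mult_double_iff(2)[OF assms, of a 0] by simp

lemma mex_add_mset_start_cong_iff:
  assumes "0 < A"
  shows "[mex A a (add_mset a \<pi>) = A + a] (mod (2 * A)) \<longleftrightarrow>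
         \<not> [mex A (a + A) \<pi> = A + (a + A)] (mod (2 * A))"
proof -
  obtain k where k: "mex A (a + A) \<pi> = (a + A) + k * A"
    using mex_props(1)[OF assms] by blast
  show ?thesis
    using cong_add_mult_double_iff[OF assms, of "a + A" k]
    unfolding mex_add_mset_start[OF assms] k by (simp add: add.commute)
qed

lemma add_mset_in_partitions_iff:
  assumes "0 < a"
  shows "add_mset a \<pi> \<in> partitions (n + a) \<longleftrightarrow> \<pi> \<in> partitions n"
  using assms by (auto simp: partitions_def)

lemma part_le_sum:
  assumes "\<pi> \<in> partitions n" and "x \<in># \<pi>"
  shows "x \<le> n"
  using assms by (auto simp: partitions_def dest!: multi_member_split)

text \<open>Every partition counted on the left contains \<open>a\<close>, as otherwise its mex is
  \<open>a\<close>, at the even position 0. Removing one copy of \<open>a\<close> yields exactly the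
  partitions of \<open>n\<close> not counted by \<open>pbar A (a + A) n\<close>.\<close>

lemma pbar_add:
  assumes "0 < A" and "0 < a"
  shows "pbar A a (n + a) = card (partitions n) - pbar A (a + A) n"
proof -
  let ?S = "{\<pi> \<in> partitions n. [mex A (a + A) \<pi> = A + (a + A)] (mod (2 * A))}"
  have "{\<pi> \<in> partitions (n + a). [mex A a \<pi> = A + a] (mod (2 * A))} =
        add_mset a ` (partitions n - ?S)" (is "?L = ?R")
  proof
    show "?L \<subseteq> ?R"
    proof
      fix \<pi> assume \<pi>: "\<pi> \<in> ?L"
      then have "a \<in># \<pi>"
        using mex_eq_start[of a \<pi> A] not_cong_add_modulus_half[OF assms(1), of a] by fastforce
      then obtain \<rho> where \<rho>: "\<pi> = add_mset a \<rho>"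
        by (blast dest: multi_member_split)
      then have "\<rho> \<in> partitions n - ?S"
        using \<pi> assms by (simp add: add_mset_in_partitions_iff mex_add_mset_start_cong_iff)
      then show "\<pi> \<in> ?R"
        using \<rho> by blast
    qed
    show "?R \<subseteq> ?L"
      using assms by (auto simp: add_mset_in_partitions_iff mex_add_mset_start_cong_iff)
  qed
  then have "pbar A a (n + a) = card (partitions n - ?S)"
    unfolding pbar_def by (simp add: card_image inj_on_def)
  also have "\<dots> = card (partitions n) - card ?S"
    by (rule card_Diff_subset) (auto intro: finite_subset[OF _ finite_partitions])
  finally show ?thesis
    unfolding pbar_def .
qed

lemma pbar_eq_0:
  assumes "0 < A" and "n < a"
  shows "pbar A a n = 0"
proof -
  have "\<not> [mex A a \<pi> = A + a] (mod (2 * A))" if "\<pi> \<in> partitions n" for \<pi>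
  proof -
    have "a \<notin># \<pi>"
      using part_le_sum[OF that] assms(2) by fastforce
    then show ?thesis
      using mex_eq_start not_cong_add_modulus_half[OF assms(1)] by metis
  qed
  then have "{\<pi> \<in> partitions n. [mex A a \<pi> = A + a] (mod (2 * A))} = {}"
    by blast
  then show ?thesis
    by (simp only: pbar_def card.empty)
qed

section \<open>Deleting and inserting the first column of a Young diagram\<close>

definition delete_column :: "nat multiset \<Rightarrow> nat multiset" where
  "delete_column \<pi> = filter_mset (\<lambda>x. 0 < x) (image_mset (\<lambda>x. x - 1) \<pi>)"

text \<open>Deleting a column loses the rows of length 1, so their number is recovered from the
  column length \<open>l\<close>. Subtraction truncates, so the new column has length
  \<open>l\<close> only when \<open>size \<pi> \<le> l\<close>.\<close>

definition insert_column :: "nat \<Rightarrow> nat multiset \<Rightarrow> nat multiset" where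
  "insert_column l \<pi> = image_mset Suc \<pi> + replicate_mset (l - size \<pi>) 1"

lemma size_delete_column_le: "size (delete_column \<pi>) \<le> size \<pi>"
  unfolding delete_column_def using size_filter_mset_lesseq[of _ "image_mset (\<lambda>x. x - 1) \<pi>"] by simp

lemma sum_delete_column:
  assumes "\<forall>x \<in># \<pi>. 0 < x"
  shows "sum_mset (delete_column \<pi>) + size \<pi> = sum_mset \<pi>"
  using assms by (induction \<pi>) (auto simp: delete_column_def)

lemma delete_insert_column:
  assumes "\<forall>x \<in># \<pi>. 0 < x"
  shows "delete_column (insert_column l \<pi>) = \<pi>"
proof -
  have "filter_mset (\<lambda>x. 0 < x) \<pi> = \<pi>"
    using assms by (simp add: filter_mset_eq_conv)
  then show ?thesis
    by (simp add: delete_column_def insert_column_def image_mset.compositionality comp_def)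
qed

lemma insert_delete_column:
  assumes "\<forall>x \<in># \<pi>. 0 < x"
  shows "insert_column (size \<pi>) (delete_column \<pi>) = \<pi>"
  using assms
proof (induction \<pi>)
  case (add x \<pi>)
  then show ?case
    \<comment> \<open>A part 1 leaves no trace in \<open>delete_column\<close> and raises the number
      of restored ones by one; the size bound moves \<open>Suc\<close> out of the truncated
      subtraction.\<close>
    using size_delete_column_le[of \<pi>]
    by (cases "x = 1") (auto simp: insert_column_def delete_column_def Suc_diff_le)
qed (simp add: insert_column_def delete_column_def)

lemma size_insert_column:
  assumes "size \<pi> \<le> l"
  shows "size (insert_column l \<pi>) = l"
  using assms by (simp add: insert_column_def)

section \<open>Rank and Dyson's map\<close>

lemma rank_add_mset_max:
  assumes "\<forall>x \<in># \<pi>. x \<le> m"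
  shows "rank (add_mset m \<pi>) = int m - int (size \<pi>) - 1"
proof -
  have "Max (set_mset (add_mset m \<pi>)) = m"
    by (rule Max_eqI) (use assms in auto)
  then show ?thesis
    by (simp add: rank_def)
qed

lemma rank_less_iff:
  assumes "\<pi> \<noteq> {#}"
  shows "rank \<pi> < c \<longleftrightarrow> (\<forall>x \<in># \<pi>. int x < int (size \<pi>) + c)"
proof -
  have "rank \<pi> < c \<longleftrightarrow> int (Max (set_mset \<pi>)) < int (size \<pi>) + c"
    by (auto simp: rank_def)
  also have "\<dots> \<longleftrightarrow> (\<forall>x \<in># \<pi>. int x < int (size \<pi>) + c)"
  proof
    assume "int (Max (set_mset \<pi>)) < int (size \<pi>) + c"
    moreover have "x \<le> Max (set_mset \<pi>)" if "x \<in># \<pi>" for x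
      using that by simp
    ultimately show "\<forall>x \<in># \<pi>. int x < int (size \<pi>) + c"
      by (meson le_less_trans of_nat_mono)
  next
    assume "\<forall>x \<in># \<pi>. int x < int (size \<pi>) + c"
    then show "int (Max (set_mset \<pi>)) < int (size \<pi>) + c"
      using assms by simp
  qed
  finally show ?thesis .
qed

text \<open>The recurrence reaches \<open>n = 0\<close>, where the only partition is empty and its
  \<open>rank\<close> rests on an unspecified \<open>Max\<close>; hence the explicit
  exclusion.\<close>

definition partitions_rank_ge :: "nat \<Rightarrow> nat \<Rightarrow> nat multiset set" where
  "partitions_rank_ge j n = {\<pi> \<in> partitions n. \<pi> \<noteq> {#} \<and> int j \<le> rank \<pi>}"

text \<open>Parts are at most \<open>size \<pi> + j + 2\<close>, so after losing a cell they fit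
  under the new row. At most \<open>size \<pi>\<close> rows survive, which gives rank at least
  \<open>j\<close>; the sum changes by \<open>j + 1\<close>.\<close>

lemma add_mset_delete_column_mem:
  assumes "\<pi> \<in> partitions n - partitions_rank_ge (j + 3) n"
  shows "add_mset (size \<pi> + j + 1) (delete_column \<pi>) \<in> partitions_rank_ge j (n + j + 1)"
    and "\<forall>x \<in># delete_column \<pi>. x \<le> size \<pi> + j + 1"
proof -
  have pos: "\<forall>x \<in># \<pi>. 0 < x" and sum: "sum_mset \<pi> = n"
    using assms by (auto simp: partitions_def)
  have "\<pi> = {#} \<or> rank \<pi> < int (j + 3)"
    using assms by (auto simp: partitions_rank_ge_def)
  then have less: "\<forall>x \<in># \<pi>. x < size \<pi> + j + 3"
    using rank_less_iff[of \<pi> "int (j + 3)"] by (cases "\<pi> = {#}") force+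
  then show le: "\<forall>x \<in># delete_column \<pi>. x \<le> size \<pi> + j + 1"
    by (fastforce simp: delete_column_def)
  have "\<forall>x \<in># delete_column \<pi>. 0 < x"
    by (simp add: delete_column_def)
  then show "add_mset (size \<pi> + j + 1) (delete_column \<pi>) \<in> partitions_rank_ge j (n + j + 1)"
    using sum_delete_column[OF pos] sum rank_add_mset_max[OF le] size_delete_column_le[of \<pi>]
    by (auto simp: partitions_rank_ge_def partitions_def)
qed

lemma card_partitions_rank_ge_add:
  "card (partitions_rank_ge j (n + j + 1)) =
   card (partitions n) - card (partitions_rank_ge (j + 3) n)"
proof -
  let ?D = "partitions n - partitions_rank_ge (j + 3) n"
  define f where "f \<pi> = add_mset (size \<pi> + j + 1) (delete_column \<pi>)" for \<pi>
  have "inj_on f ?D"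
  proof
    fix \<pi> \<rho> assume \<pi>: "\<pi> \<in> ?D" and \<rho>: "\<rho> \<in> ?D" and eq: "f \<pi> = f \<rho>"
    \<comment> \<open>The largest part of the image reveals the length of the deleted column, which
      is what is needed to reinsert it.\<close>
    have max: "Max (set_mset (f \<sigma>)) = size \<sigma> + j + 1" if "\<sigma> \<in> ?D" for \<sigma>
      unfolding f_def by (rule Max_eqI) (use add_mset_delete_column_mem(2)[OF that] in auto)
    have size: "size \<pi> = size \<rho>"
      using max[OF \<pi>] max[OF \<rho>] eq by simp
    then have "delete_column \<pi> = delete_column \<rho>"
      using eq by (simp add: f_def)
    moreover have "\<forall>x \<in># \<pi>. 0 < x" "\<forall>x \<in># \<rho>. 0 < x"
      using \<pi> \<rho> by (auto simp: partitions_def)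
    ultimately show "\<pi> = \<rho>"
      using size insert_delete_column by metis
  qed
  moreover have "f ` ?D = partitions_rank_ge j (n + j + 1)"
  proof
    show "f ` ?D \<subseteq> partitions_rank_ge j (n + j + 1)"
      using add_mset_delete_column_mem(1) by (auto simp: f_def)
    show "partitions_rank_ge j (n + j + 1) \<subseteq> f ` ?D"
    proof
      fix \<mu> assume \<mu>: "\<mu> \<in> partitions_rank_ge j (n + j + 1)"
      then have nonempty: "\<mu> \<noteq> {#}"
        by (simp add: partitions_rank_ge_def)
      define m where "m = Max (set_mset \<mu>)"
      have "m \<in># \<mu>"
        unfolding m_def using nonempty by simp
      then obtain \<nu> where \<nu>: "\<mu> = add_mset m \<nu>"
        by (blast dest: multi_member_split)
      have "\<forall>x \<in># \<mu>. x \<le> m"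
        unfolding m_def by simp
      then have le: "\<forall>x \<in># \<nu>. x \<le> m"
        by (simp add: \<nu>)
      have "int j \<le> rank \<mu>"
        using \<mu> by (simp add: partitions_rank_ge_def)
      then have large: "size \<nu> + j + 1 \<le> m"
        using rank_add_mset_max[OF le] by (simp add: \<nu>)
      have pos: "\<forall>x \<in># \<nu>. 0 < x" and sum: "m + sum_mset \<nu> = n + j + 1"
        using \<mu> by (auto simp: partitions_rank_ge_def partitions_def \<nu>)
      \<comment> \<open>The largest part should be \<open>l + j + 1\<close> for the deleted column
        length \<open>l\<close>; by \<open>large\<close>, this \<open>l\<close> is at least
        \<open>size \<nu>\<close>, so the column meets every row.\<close>
      define \<pi> where "\<pi> = insert_column (m - (j + 1)) \<nu>"
      have delete: "delete_column \<pi> = \<nu>"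
        unfolding \<pi>_def by (rule delete_insert_column[OF pos])
      have size: "size \<pi> = m - (j + 1)"
        unfolding \<pi>_def by (rule size_insert_column) (use large in simp)
      have pos': "\<forall>x \<in># \<pi>. 0 < x"
        by (auto simp: \<pi>_def insert_column_def)
      have "sum_mset \<pi> = n"
        using sum_delete_column[OF pos'] delete size sum large by simp
      then have "\<pi> \<in> partitions n"
        using pos' by (simp add: partitions_def)
      \<comment> \<open>Each part is 1 or \<open>Suc x\<close> with \<open>x \<le> m\<close>, hence
        below \<open>m + 2\<close>, which is \<open>size \<pi> + (j + 3)\<close>.\<close>
      moreover have "\<forall>x \<in># \<pi>. x < size \<pi> + (j + 3)"
        using le large unfolding size by (auto simp: \<pi>_def insert_column_def)
      then have "\<pi> = {#} \<or> rank \<pi> < int (j + 3)"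
        using rank_less_iff[of \<pi> "int (j + 3)"] by fastforce
      then have "\<pi> \<notin> partitions_rank_ge (j + 3) n"
        by (auto simp: partitions_rank_ge_def)
      moreover have "f \<pi> = \<mu>"
        using large by (simp add: f_def delete size \<nu>)
      ultimately show "\<mu> \<in> f ` ?D"
        by blast
    qed
  qed
  ultimately have "card (partitions_rank_ge j (n + j + 1)) = card ?D"
    using card_image by metis
  also have "\<dots> = card (partitions n) - card (partitions_rank_ge (j + 3) n)"
    by (rule card_Diff_subset)
      (auto simp: partitions_rank_ge_def intro: finite_subset[OF _ finite_partitions])
  finally show ?thesis .
qed

lemma partitions_rank_ge_empty:
  assumes "n \<le> j"
  shows "partitions_rank_ge j n = {}"
proof -
  have False if \<pi>: "\<pi> \<in> partitions n" "\<pi> \<noteq> {#}" "int j \<le> rank \<pi>" for \<pi>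
  proof -
    have "Max (set_mset \<pi>) \<le> n"
      using part_le_sum[OF \<pi>(1)] \<pi>(2) by simp
    moreover have "0 < size \<pi>"
      using \<pi>(2) by (simp add: nonempty_has_size)
    ultimately show False
      using \<pi>(3) assms by (simp add: rank_def)
  qed
  then show ?thesis
    by (auto simp: partitions_rank_ge_def)
qed

text \<open>The progression step 3 agrees with the shift from \<open>j\<close> to
  \<open>j + 3\<close> in Dyson's map, so both recurrences coincide. As \<open>j\<close> changes
  while \<open>n\<close> decreases, the induction is on \<open>n\<close> for all
  \<open>j\<close>.\<close>

lemma pbar_eq_card_partitions_rank_ge:
  "pbar 3 (j + 1) n = card (partitions_rank_ge j n)"
proof (induction n arbitrary: j rule: less_induct)
  case (less n)
  show ?case
  proof (cases "n \<le> j")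
    case True
    then show ?thesis
      by (simp add: pbar_eq_0 partitions_rank_ge_empty)
  next
    case False
    define m where "m = n - (j + 1)"
    have n: "n = m + (j + 1)" and "m < n"
      using False by (auto simp: m_def)
    have "pbar 3 (j + 1) n = card (partitions m) - pbar 3 (j + 3 + 1) m"
      unfolding n using pbar_add[of 3 "j + 1" m] by (simp add: ac_simps)
    also have "\<dots> = card (partitions m) - card (partitions_rank_ge (j + 3) m)"
      by (simp only: less.IH[OF \<open>m < n\<close>])
    also have "\<dots> = card (partitions_rank_ge j n)"
      unfolding n using card_partitions_rank_ge_add[of j m] by (simp add: ac_simps)
    finally show ?thesis .
  qed
qed

theorem theorem3p3:
  fixes j n :: nat
  assumes "0 < n"
  shows "pbar 3 (j + 1) n = card {\<pi> \<in> partitions n. rank \<pi> \<ge> int j}"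
proof -
  \<comment> \<open>For \<open>0 < n\<close> the empty partition does not occur, so excluding it
    changes nothing.\<close>
  have "{\<pi> \<in> partitions n. rank \<pi> \<ge> int j} = partitions_rank_ge j n"
    using assms by (auto simp: partitions_rank_ge_def partitions_def)
  then show ?thesis
    by (simp only: pbar_eq_card_partitions_rank_ge)
qed

end
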